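(* Let $n\ge 2$ and let $\mathcal{G}_n$ be the $n$-agent mean-field game with action interval $[a,b]$, utility family $u$ and parameters $\alpha_1,\dots,\alpha_n\in\mathbb{R}$ described in the context, whose best response function $\mathrm{Br}$ is Lipschitz in $z$ with constant $L_z<1$ and Lipschitz in $\alpha$ with constant $L$. Then $\mathcal{G}_n$ admits a unique Nash equilibrium.
   Context: Game. Let $a\le b$ be reals, $u:[a,b]\times\mathbb{R}\times\mathbb{R}\to\mathbb{R}$ a function, and $\alpha_1,\dots,\alpha_n\in\mathbb{R}$. $\mathcal{G}_n$ is the non-cooperative game with agents $1,\dots,n$ in which agent $i$ chooses an action $x_i\in[a,b]$ and maximizes the utility $u(x_i,z_{i,n},\alpha_i)$, where $z_{i,n}=\frac{1}{n-1}\sum_{j\ne i}x_j$ is the mean variable of agent $i$. Best response. $\mathrm{Br}(z,\alpha)=\arg\max_{a\le x\le b}u(x,z,\alpha)$; for all $z,\alpha\in\mathbb{R}$ the maximizer is assumed to exist and be unique, so $\mathrm{Br}:\mathbb{R}\times\mathbb{R}\to[a,b]$ is a function. Assumptions. (1) There is a constant $0<L_z<1$ with $|\mathrm{Br}(z,\alpha)-\mathrm{Br}(z',\alpha)|\le L_z|z-z'|$ for all $z,z',\alpha\in\mathbb{R}$. (2) There is a constant $L>0$ with $|\mathrm{Br}(z,\alpha)-\mathrm{Br}(z,\alpha')|\le L|\alpha-\alpha'|$ for all $z,\alpha,\alpha'\in\mathbb{R}$. Nash equilibrium. A Nash equilibrium of $\mathcal{G}_n$ is $(x^\star_{1,n},\dots,x^\star_{n,n})\in[a,b]^n$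 such that for every $i$, $x^\star_{i,n}=\arg\max_{a\le x_i\le b}u(x_i,z^\star_{i,n},\alpha_i)$, i.e. $x^\star_{i,n}=\mathrm{Br}(z^\star_{i,n},\alpha_i)$, where $z^\star_{i,n}=\frac{1}{n-1}\sum_{j\ne i}x^\star_{j,n}$. *)

theory Defs
  imports "HOL-Analysis.Analysis"
begin

definition mean_variable :: "nat \<Rightarrow> (nat \<Rightarrow> real) \<Rightarrow> nat \<Rightarrow> real" where
  "mean_variable n x i = (\<Sum>j\<in>{1..n} - {i}. x j) / (real n - 1)"

definition best_reply ::
    "real \<Rightarrow> real \<Rightarrow> (real \<Rightarrow> real \<Rightarrow> real \<Rightarrow> real) \<Rightarrow> real \<Rightarrow> real \<Rightarrow> real \<Rightarrow> bool" where
  "best_reply a b u z \<alpha> x \<longleftrightarrow> is_arg_max (\<lambda>y. u y z \<alpha>) (\<lambda>y. y \<in> {a..b}) x"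

(* Meaningful only when the maximizer exists and is unique. *)
definition Br ::
    "real \<Rightarrow> real \<Rightarrow> (real \<Rightarrow> real \<Rightarrow> real \<Rightarrow> real) \<Rightarrow> real \<Rightarrow> real \<Rightarrow> real" where
  "Br a b u z \<alpha> = (THE x. best_reply a b u z \<alpha> x)"

(* Profiles are extensional functions on {1..n}, i.e. points of [a,b]^n, so equality of
   profiles is equality of all n components.  Only \<alpha> 1, ..., \<alpha> n are relevant. *)
definition nash_equilibrium ::
    "real \<Rightarrow> real \<Rightarrow> (real \<Rightarrow> real \<Rightarrow> real \<Rightarrow> real) \<Rightarrow> nat \<Rightarrow> (nat \<Rightarrow> real) \<Rightarrow> (nat \<Rightarrow> real) \<Rightarrow> bool" where
  "nash_equilibrium a b u n \<alpha> x \<longleftrightarrow>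
     x \<in> {1..n} \<rightarrow>\<^sub>E {a..b} \<and>
     (\<forall>i\<in>{1..n}. best_reply a b u (mean_variable n x i) (\<alpha> i) (x i))"

end

theory Submission
  imports Defs
begin

text \<open>
  An equilibrium is a fixed point of the joint best response map, which sends a profile \<open>x\<close> to
  the profile with components \<open>Br (mean_variable n x i) (\<alpha> i)\<close>. Averaging over the other
  agents does not increase the maximum distance of two profiles, and \<open>Br\<close> shrinks
  distances of mean variables by the factor \<open>L\<^sub>z < 1\<close>. The joint best response is therefore
  a contraction for the maximum norm, and Banach's theorem provides exactly one fixed point
  (\<open>max_norm_contraction_ex1\<close>).
\<close>

text \<open>
  The extensional functions on a finite set of indices are all bounded, so they form the whole
  space of bounded functions on it; with the supremum distance that space is complete, and
  Banach's fixed point theorem applies.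
\<close>
lemma max_norm_contraction_ex1:
  fixes F :: "('i \<Rightarrow> real) \<Rightarrow> 'i \<Rightarrow> real"
  assumes "finite I" and "c < 1"
    and contr: "\<And>x y d i. i \<in> I \<Longrightarrow> (\<And>j. j \<in> I \<Longrightarrow> \<bar>x j - y j\<bar> \<le> d)
                  \<Longrightarrow> \<bar>F x i - F y i\<bar> \<le> c * d"
  shows "\<exists>!x. x \<in> extensional I \<and> (\<forall>i\<in>I. x i = F x i)"
proof (cases "I = {}")
  case True
  then show ?thesis by simp
next
  case False
  let ?S = "Met_TC.fspace I :: ('i \<Rightarrow> real) set"
  have space: "?S = extensional I"
    using \<open>finite I\<close> by (auto simp: Met_TC.fspace_def finite_imp_bounded)
  interpret Sup: Metric_space ?S "Met_TC.fdist I"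
    by (rule Met_TC.Metric_space_funspace)
  have dist_le_iff: "Met_TC.fdist I x y \<le> d \<longleftrightarrow> (\<forall>i\<in>I. \<bar>x i - y i\<bar> \<le> d)"
    if "x \<in> ?S" "y \<in> ?S" for x y and d :: real
    using Met_TC.funspace_mdist_le[OF that False] by (simp add: dist_real_def)
  define T where "T x = restrict (F x) I" for x
  have maps: "T \<in> ?S \<rightarrow> ?S"
    by (simp add: space T_def)
  have contraction: "Met_TC.fdist I (T x) (T y) \<le> c * Met_TC.fdist I x y"
    if "x \<in> ?S" "y \<in> ?S" for x y
  proof -
    have "\<bar>F x i - F y i\<bar> \<le> c * Met_TC.fdist I x y" if "i \<in> I" for i
      using contr[OF that] dist_le_iff[OF \<open>x \<in> ?S\<close> \<open>y \<in> ?S\<close>] by blast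
    then show ?thesis
      by (subst dist_le_iff) (auto simp: space T_def)
  qed
  have "Met_TC.mcomplete TYPE(real)"
    using complete_UNIV by blast
  then have "Sup.mcomplete"
    using Met_TC.mcomplete_funspace[of I] by (simp add: mcomplete_of_def)
  moreover have "?S \<noteq> {}"
    unfolding space using restrict_extensional by blast
  ultimately obtain x where x: "x \<in> ?S" "T x = x"
    using Sup.Banach_fixedpoint_thm[OF _ _ maps \<open>c < 1\<close> contraction] by blast
  have fixpoint_iff: "T y = y \<longleftrightarrow> (\<forall>i\<in>I. y i = F y i)" if "y \<in> extensional I" for y
    using that by (auto simp: T_def restrict_def extensional_def fun_eq_iff)
  show ?thesis
  proof (rule ex1I)
    show "x \<in> extensional I \<and> (\<forall>i\<in>I. x i = F x i)"
      using x fixpoint_iff space by blast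
  next
    fix y assume y: "y \<in> extensional I \<and> (\<forall>i\<in>I. y i = F y i)"
    then have "T y = y" "y \<in> ?S"
      using fixpoint_iff space by auto
    then show "y = x"
      using Sup.contraction_imp_unique_fixpoint[OF _ _ maps \<open>c < 1\<close> contraction] x by blast
  qed
qed

lemma mean_variable_nonexpansive:
  assumes "n \<ge> 2" and "i \<in> {1..n}"
    and close: "\<And>j. j \<in> {1..n} \<Longrightarrow> \<bar>x j - y j\<bar> \<le> d"
  shows "\<bar>mean_variable n x i - mean_variable n y i\<bar> \<le> d"
proof -
  have "\<bar>(\<Sum>j\<in>{1..n} - {i}. x j) - (\<Sum>j\<in>{1..n} - {i}. y j)\<bar>
        \<le> (\<Sum>j\<in>{1..n} - {i}. \<bar>x j - y j\<bar>)"
    unfolding sum_subtractf[symmetric] by (rule sum_abs)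
  also have "\<dots> \<le> of_nat (card ({1..n} - {i})) * d"
    by (rule sum_bounded_above) (use close in blast)
  also have "\<dots> = (real n - 1) * d"
    using assms(1,2) by (simp add: of_nat_diff)
  finally show ?thesis
    using \<open>n \<ge> 2\<close>
    by (simp add: mean_variable_def diff_divide_distrib[symmetric] pos_divide_le_eq mult.commute)
qed

lemma best_reply_iff_eq_Br:
  assumes "\<exists>!x. best_reply a b u z \<beta> x"
  shows "best_reply a b u z \<beta> x \<longleftrightarrow> x = Br a b u z \<beta>"
  unfolding Br_def using assms theI'[OF assms] by blast

theorem lemma1:
  fixes a b L\<^sub>z L :: real
    and u :: "real \<Rightarrow> real \<Rightarrow> real \<Rightarrow> real"
    and n :: nat
    and \<alpha> :: "nat \<Rightarrow> real"
  assumes "a \<le> b"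
    and "n \<ge> 2"
    and "\<And>z \<beta>. \<exists>!x. best_reply a b u z \<beta> x"
    and "0 < L\<^sub>z" and "L\<^sub>z < 1"
    and "\<And>z z' \<beta>. \<bar>Br a b u z \<beta> - Br a b u z' \<beta>\<bar> \<le> L\<^sub>z * \<bar>z - z'\<bar>"
    and "0 < L"
    and "\<And>z \<beta> \<beta>'. \<bar>Br a b u z \<beta> - Br a b u z \<beta>'\<bar> \<le> L * \<bar>\<beta> - \<beta>'\<bar>"
  shows "\<exists>!x. nash_equilibrium a b u n \<alpha> x"
proof -
  define F where "F x i = Br a b u (mean_variable n x i) (\<alpha> i)" for x i
  have "\<bar>F x i - F y i\<bar> \<le> L\<^sub>z * d"
    if "i \<in> {1..n}" and "\<And>j. j \<in> {1..n} \<Longrightarrow> \<bar>x j - y j\<bar> \<le> d" for x y d i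
  proof -
    have "\<bar>F x i - F y i\<bar> \<le> L\<^sub>z * \<bar>mean_variable n x i - mean_variable n y i\<bar>"
      unfolding F_def by (rule assms(6))
    also have "\<dots> \<le> L\<^sub>z * d"
      using mean_variable_nonexpansive[OF \<open>n \<ge> 2\<close> that] \<open>0 < L\<^sub>z\<close>
      by (intro mult_left_mono) auto
    finally show ?thesis .
  qed
  then have "\<exists>!x. x \<in> extensional {1..n} \<and> (\<forall>i\<in>{1..n}. x i = F x i)"
    using \<open>0 < L\<^sub>z\<close> \<open>L\<^sub>z < 1\<close> by (intro max_norm_contraction_ex1[where c = L\<^sub>z]) auto
  moreover have "nash_equilibrium a b u n \<alpha> x \<longleftrightarrow>
      x \<in> extensional {1..n} \<and> (\<forall>i\<in>{1..n}. x i = F x i)" for x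
  proof -
    \<comment> \<open>A best reply lies in the action interval, so the fixed point equation alone makes the
        profile feasible.\<close>
    have "x i \<in> {a..b}" if "x i = F x i" for i
      using that best_reply_iff_eq_Br[OF assms(3)]
      by (metis F_def best_reply_def is_arg_max_def)
    then show ?thesis
      unfolding nash_equilibrium_def best_reply_iff_eq_Br[OF assms(3)] F_def[symmetric]
      by (auto simp: PiE_def)
  qed
  ultimately show ?thesis
    by simp
qed

end
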